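(* Consider a pigeonhole PPS scenario (as defined in the context) with pre-selected state $\rho_I$ and post-selected state $\rho_F$ on $(\mathbb{C}^2)^{\otimes 3}$, and let $\Theta=\Pi^{\mathrm{same}}_{12}+\Pi^{\mathrm{same}}_{13}+\Pi^{\mathrm{same}}_{23}$. Then the sum of ABL statistics satisfies $$\sum_{\{i,j\}\in P_3}p(\mathrm{same}_{ij}\mid\rho_I,\rho_F,\mathcal{M}_{ij})=\mathrm{Re}\big(\langle\Theta\rangle_w\big).$$ Consequently, a pigeonhole paradox occurs if and only if the weak value of $\Theta$ falls below its minimum eigenvalue, $$\mathrm{Re}\big(\langle\Theta\rangle_w\big)<1,$$ that is, if and only if $\langle\Theta\rangle_w$ is anomalous.
   Context: A state on a finite-dimensional Hilbert space is a density operator (positive semidefinite, trace one). Pigeonhole PPS (pre- and post-selection) scenario. Let $\{|L\rangle,|R\rangle\}$ be an orthonormal basis of $\mathbb{C}^2$ and $C=\{|c_1c_2c_3\rangle=|c_1\rangle\otimes|c_2\rangle\otimes|c_3\rangle\}_{c_i\in\{L,R\}}$ the product orthonormal basis of $\mathcal{H}=(\mathbb{C}^2)^{\otimes 3}$. Let $P_3=\{\{i,j\}: i,j\in\{1,2,3\},\ i\ne j\}$ be the set of the three unordered pairs. For $\{i,j\}\in P_3$ let $$\Pi^{\mathrm{same}}_{ij}=|LL\rangle\langle LL|_{ij}\otimes\mathbb{1}_2+|RR\rangle\langle RR|_{ij}\otimes\mathbb{1}_2,\qquad \Pi^{\mathrm{diff}}_{ij}=\mathbb{1}_8-\Pi^{\mathrm{same}}_{ij},$$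 where the subscript $ij$ means acting on tensor factors $i,j$ and $\mathbb{1}_2$ acts on the remaining factor; i.e. $\Pi^{\mathrm{same}}_{ij}$ is the orthogonal projector onto the span of the basis vectors $|c_1c_2c_3\rangle$ with $c_i=c_j$. The intermediate measurement is $\mathcal{M}_{ij}=\{\Pi^{\mathrm{same}}_{ij},\Pi^{\mathrm{diff}}_{ij}\}$ with outcomes $\mathrm{same}_{ij},\mathrm{diff}_{ij}$. The data are states $\rho_I$ (pre-selected) and $\rho_F$ (post-selected) on $\mathcal{H}$; the post-selection measurement is $\mathcal{M}_F=\{\rho_F,\mathbb{1}-\rho_F\}$, with "pass" denoting outcome $\rho_F$. The probabilities (Lüders rule) are $$p(\mathrm{same}_{ij},\mathrm{pass})=\mathrm{Tr}[\rho_F\Pi^{\mathrm{same}}_{ij}\rho_I\Pi^{\mathrm{same}}_{ij}],\quad p(\mathrm{diff}_{ij},\mathrm{pass})=\mathrm{Tr}[\rho_F\Pi^{\mathrm{diff}}_{ij}\rho_I\Pi^{\mathrm{diff}}_{ij}],\quad p(\mathrm{pass}\mid\rho_I,\mathcal{M}_F)=\mathrm{Tr}[\rho_F\rho_I],$$ the last one being the probability of passing when no intermediate measurement is performed. The scenario is required to satisfy: (i) operational non-disturbance: $p(\mathrm{same}_{ij},\mathrm{pass})+p(\mathrm{diff}_{ij},\mathrm{pass})=p(\mathrm{pass}\mid\rho_I,\mathcal{M}_F)$ for every $\{i,j\}\in P_3$; (ii) $p(\mathrm{pass}\mid\rho_I,\mathcal{M}_F)=\mathrm{Tr}[\rho_F\rho_I]\ne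 0$; (iii) when the three pair-checks are performed sequentially (in any order) on $\rho_I$ without post-selection, the probability of obtaining all three outcomes $\mathrm{diff}$ is zero: $p(\mathrm{diff}_{12},\mathrm{diff}_{13},\mathrm{diff}_{23}\mid\rho_I,\mathcal{M}_{12},\mathcal{M}_{13},\mathcal{M}_{23})=\mathrm{Tr}[K\rho_I K^\dagger]=0$ with $K=\Pi^{\mathrm{diff}}_{23}\Pi^{\mathrm{diff}}_{13}\Pi^{\mathrm{diff}}_{12}$, and likewise for the other orders. ABL (Aharonov–Bergmann–Lebowitz) rule: for $\{i,j\}\in P_3$, $$p(\mathrm{same}_{ij}\mid\rho_I,\rho_F,\mathcal{M}_{ij})=\frac{p(\mathrm{same}_{ij},\mathrm{pass})}{p(\mathrm{same}_{ij},\mathrm{pass})+p(\mathrm{diff}_{ij},\mathrm{pass})}.$$ A pigeonhole paradox is a violation of the inequality $\sum_{\{i,j\}\in P_3}p(\mathrm{same}_{ij}\mid\rho_I,\rho_F,\mathcal{M}_{ij})\ge 1$. Weak value of a Hermitian operator $A$ with pre-selected state $\rho_I$ and post-selected state $\rho_F$: $$\langle A\rangle_w=\frac{\mathrm{Tr}[\rho_F A\rho_I]}{\mathrm{Tr}[\rho_F\rho_I]}\in\mathbb{C}.$$ The weak value $\langle A\rangle_w$ is called anomalous whenever it lies outside the interval $[\lambda_{\min},\lambda_{\max}]\subset\mathbb{R}$ given by the smallest and largest eigenvalues of $A$. The operator $\Theta$ is diagonal in $C$ with spectrum $\{1,3\}$, so for $A=\Theta$ this interval is $[1,3]$.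
   Formalization: "Anomalous" is read as Re⟨Θ⟩_w lying outside [1,3]; with the complex value itself the equivalence fails (⟨Θ⟩_w may be 3/2+3i/2 without a paradox), and then only "paradox implies anomalous", and the equivalence for real ⟨Θ⟩_w, are stated. *)

theory Defs
  imports "HOL-Analysis.Analysis"
begin

section \<open>Operators, states, eigenvalues\<close>

definition adj :: "complex^'n^'n \<Rightarrow> complex^'n^'n" where
  "adj A = (\<chi> i j. cnj (A $ j $ i))"

definition hermitian :: "complex^'n^'n \<Rightarrow> bool" where
  "hermitian A \<longleftrightarrow> adj A = A"

(* For hermitian A the quadratic form is real, so taking Re discards nothing. *)
definition psd :: "complex^'n^'n \<Rightarrow> bool" where
  "psd A \<longleftrightarrow> hermitian A \<and> (\<forall>v. 0 \<le> Re (\<Sum>i\<in>UNIV. cnj (v $ i) * (A *v v) $ i))"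

definition state :: "complex^'n^'n \<Rightarrow> bool" where
  "state \<rho> \<longleftrightarrow> psd \<rho> \<and> trace \<rho> = 1"

(* Real eigenvalues; only used for hermitian operators, which have no others. *)
definition eigenvalues :: "complex^'n^'n \<Rightarrow> real set" where
  "eigenvalues A = {l. \<exists>v. v \<noteq> 0 \<and> A *v v = complex_of_real l *s v}"

definition min_eigenvalue :: "complex^'n^'n \<Rightarrow> real" where
  "min_eigenvalue A = Min (eigenvalues A)"

definition max_eigenvalue :: "complex^'n^'n \<Rightarrow> real" where
  "max_eigenvalue A = Max (eigenvalues A)"

section \<open>Weak values\<close>

definition weak_value :: "complex^'n^'n \<Rightarrow> complex^'n^'n \<Rightarrow> complex^'n^'n \<Rightarrow> complex" where
  "weak_value \<rho>\<^sub>I \<rho>\<^sub>F A = trace (\<rho>\<^sub>F ** A ** \<rho>\<^sub>I) / trace (\<rho>\<^sub>F ** \<rho>\<^sub>I)"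

(* Weak values are compared with the spectrum through their real part: operational
   non-disturbance does not make the weak value of Theta below real. *)
definition anomalous :: "complex^'n^'n \<Rightarrow> complex^'n^'n \<Rightarrow> complex^'n^'n \<Rightarrow> bool" where
  "anomalous \<rho>\<^sub>I \<rho>\<^sub>F A \<longleftrightarrow>
     Re (weak_value \<rho>\<^sub>I \<rho>\<^sub>F A) \<notin> {min_eigenvalue A..max_eigenvalue A}"

(* The alternative reading: the complex number itself is not a point of the real interval,
   so that every non-real weak value is anomalous.  In the pigeonhole scenario this does not
   imply a paradox: for the pure states with amplitudes 1/2, 1/2, 1/2, 1/2 (pre-selected) and
   (1 - 3i)/4, (1 + i)/4, (1 + i)/4, (1 + i)/4 (post-selected) on LLL, LLR, LRL, RLL, the
   weak value of Theta is 3/2 + 3i/2, while the ABL probabilities sum to 3/2. *)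
definition complex_anomalous :: "complex^'n^'n \<Rightarrow> complex^'n^'n \<Rightarrow> complex^'n^'n \<Rightarrow> bool" where
  "complex_anomalous \<rho>\<^sub>I \<rho>\<^sub>F A \<longleftrightarrow>
     weak_value \<rho>\<^sub>I \<rho>\<^sub>F A \<notin> complex_of_real ` {min_eigenvalue A..max_eigenvalue A}"

section \<open>The pigeonhole scenario\<close>

datatype box = L | R

lemma UNIV_box: "UNIV = {L, R}"
  by (auto intro: box.exhaust)

instance box :: finite
  by standard (simp add: UNIV_box)

(* Operators on the threefold tensor power of complex^box are matrices in the product basis.
   The factors are labelled by the three-element type 3 (in which the numeral 3 equals 0),
   so a basis vector is a function c :: 3 => box, with c k its k-th component. *)
type_synonym op1 = "complex^box^box"
type_synonym op3 = "complex^(3 \<Rightarrow> box)^(3 \<Rightarrow> box)"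

definition tensor3 :: "(3 \<Rightarrow> op1) \<Rightarrow> op3" where
  "tensor3 A = (\<chi> c d. \<Prod>k\<in>UNIV. A k $ c k $ d k)"

definition basis_proj :: "box \<Rightarrow> op1" where
  "basis_proj b = (\<chi> x y. if x = b \<and> y = b then 1 else 0)"

definition pairs :: "3 set set" where
  "pairs = {{i, j} | i j. i \<noteq> j}"

definition Pi_same :: "3 set \<Rightarrow> op3" where
  "Pi_same p = tensor3 (\<lambda>k. if k \<in> p then basis_proj L else mat 1)
             + tensor3 (\<lambda>k. if k \<in> p then basis_proj R else mat 1)"

definition Pi_diff :: "3 set \<Rightarrow> op3" where
  "Pi_diff p = mat 1 - Pi_same p"

definition Theta :: op3 where
  "Theta = Pi_same {1, 2} + Pi_same {1, 3} + Pi_same {2, 3}"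

(* For states the traces below are real, being traces of products of two positive
   semidefinite operators (or of one such operator). *)
definition p_same_pass :: "op3 \<Rightarrow> op3 \<Rightarrow> 3 set \<Rightarrow> real" where
  "p_same_pass \<rho>\<^sub>I \<rho>\<^sub>F p = Re (trace (\<rho>\<^sub>F ** Pi_same p ** \<rho>\<^sub>I ** Pi_same p))"

definition p_diff_pass :: "op3 \<Rightarrow> op3 \<Rightarrow> 3 set \<Rightarrow> real" where
  "p_diff_pass \<rho>\<^sub>I \<rho>\<^sub>F p = Re (trace (\<rho>\<^sub>F ** Pi_diff p ** \<rho>\<^sub>I ** Pi_diff p))"

definition p_pass :: "op3 \<Rightarrow> op3 \<Rightarrow> real" where
  "p_pass \<rho>\<^sub>I \<rho>\<^sub>F = Re (trace (\<rho>\<^sub>F ** \<rho>\<^sub>I))"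

(* The head of the list is the pair checked first, hence the rightmost factor. *)
fun diff_sequence :: "3 set list \<Rightarrow> op3" where
  "diff_sequence [] = mat 1"
| "diff_sequence (p # ps) = diff_sequence ps ** Pi_diff p"

definition p_all_diff :: "op3 \<Rightarrow> 3 set list \<Rightarrow> real" where
  "p_all_diff \<rho>\<^sub>I ps = Re (trace (diff_sequence ps ** \<rho>\<^sub>I ** adj (diff_sequence ps)))"

definition pigeonhole_PPS :: "op3 \<Rightarrow> op3 \<Rightarrow> bool" where
  "pigeonhole_PPS \<rho>\<^sub>I \<rho>\<^sub>F \<longleftrightarrow>
     state \<rho>\<^sub>I \<and> state \<rho>\<^sub>F \<and>
     (\<forall>p\<in>pairs. p_same_pass \<rho>\<^sub>I \<rho>\<^sub>F p + p_diff_pass \<rho>\<^sub>I \<rho>\<^sub>F p = p_pass \<rho>\<^sub>I \<rho>\<^sub>F) \<and>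
     p_pass \<rho>\<^sub>I \<rho>\<^sub>F \<noteq> 0 \<and>
     (\<forall>ps. distinct ps \<and> set ps = pairs \<longrightarrow> p_all_diff \<rho>\<^sub>I ps = 0)"

definition ABL_same :: "op3 \<Rightarrow> op3 \<Rightarrow> 3 set \<Rightarrow> real" where
  "ABL_same \<rho>\<^sub>I \<rho>\<^sub>F p =
     p_same_pass \<rho>\<^sub>I \<rho>\<^sub>F p / (p_same_pass \<rho>\<^sub>I \<rho>\<^sub>F p + p_diff_pass \<rho>\<^sub>I \<rho>\<^sub>F p)"

definition pigeonhole_paradox :: "op3 \<Rightarrow> op3 \<Rightarrow> bool" where
  "pigeonhole_paradox \<rho>\<^sub>I \<rho>\<^sub>F \<longleftrightarrow> \<not> (\<Sum>p\<in>pairs. ABL_same \<rho>\<^sub>I \<rho>\<^sub>F p) \<ge> 1"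

end

theory Submission
  imports Defs
begin

text \<open>Write $S$ for \<^term>\<open>Pi_same p\<close>. Expanding $\mathrm{Tr}[\rho_F(1-S)\rho_I(1-S)]$ turns
  non-disturbance into $\mathrm{Tr}[\rho_F S\rho_I S]=\mathrm{Re}\,\mathrm{Tr}[\rho_F S\rho_I]$,
  so each ABL probability is the real part of a weak value. These probabilities are at most 1
  because $\mathrm{Tr}[AB]\ge 0$ for positive semidefinite $A$, $B$, so their sum never exceeds 3,
  the largest eigenvalue of \<^const>\<open>Theta\<close>: the weak value can only be anomalous from below.\<close>

section \<open>Matrix algebra\<close>

text \<open>The library states this only for real matrices.\<close>

lemma matrix_vector_mult_axis:
  fixes A :: "'a::semiring_1^'n^'m"
  shows "A *v axis k 1 = column k A"
proof -
  have "A $ i $ j * axis k 1 $ j = (if j = k then A $ i $ j else 0)" for i j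
    by (simp add: axis_def)
  then show ?thesis
    by (simp add: vec_eq_iff matrix_vector_mult_def column_def)
qed

lemma matrix_add_rdistrib:
  fixes A B :: "'a::semiring_1^'n^'m"
  shows "(A + B) ** C = A ** C + B ** C"
  by (simp add: vec_eq_iff matrix_matrix_mult_def distrib_right sum.distrib)

lemma matrix_diff_ldistrib:
  fixes A :: "'a::ring_1^'n^'m"
  shows "A ** (B - C) = A ** B - A ** C"
  by (simp add: vec_eq_iff matrix_matrix_mult_def right_diff_distrib sum_subtractf)

lemma matrix_diff_rdistrib:
  fixes A B :: "'a::ring_1^'n^'m"
  shows "(A - B) ** C = A ** C - B ** C"
  by (simp add: vec_eq_iff matrix_matrix_mult_def left_diff_distrib sum_subtractf)

section \<open>Positive semidefinite matrices\<close>

definition quad_form :: "complex^'n^'n \<Rightarrow> complex^'n \<Rightarrow> complex" where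
  "quad_form A v = (\<Sum>i\<in>UNIV. cnj (v $ i) * (A *v v) $ i)"

lemma psd_iff: "psd A \<longleftrightarrow> hermitian A \<and> (\<forall>v. 0 \<le> Re (quad_form A v))"
  by (simp add: psd_def quad_form_def)

lemma psd_quad_form: "psd A \<Longrightarrow> 0 \<le> Re (quad_form A v)"
  by (simp add: psd_iff)

lemma adj_nth [simp]: "adj A $ i $ j = cnj (A $ j $ i)"
  by (simp add: adj_def)

lemma hermitian_iff: "hermitian A \<longleftrightarrow> (\<forall>i j. cnj (A $ i $ j) = A $ j $ i)"
  by (auto simp: hermitian_def vec_eq_iff)

lemma hermitian_cnj: "hermitian A \<Longrightarrow> cnj (A $ i $ j) = A $ j $ i"
  by (simp add: hermitian_iff)

lemma adj_mult: "adj (A ** B) = adj B ** adj A"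
  by (simp add: vec_eq_iff matrix_matrix_mult_def mult.commute)

lemma trace_adj: "trace (adj A) = cnj (trace A)"
  by (simp add: trace_def)

lemma hermitian_diag_real:
  "hermitian A \<Longrightarrow> A $ x $ x = complex_of_real (Re (A $ x $ x))"
  using hermitian_cnj[of A x x] by (simp add: complex_eq_iff)

lemma quad_form_adjoint: "(\<Sum>i\<in>UNIV. cnj (u $ i) * (A *v w) $ i)
    = (\<Sum>i\<in>UNIV. cnj ((adj A *v u) $ i) * w $ i)"
  unfolding matrix_vector_mult_def
  by (simp add: sum_distrib_left sum_distrib_right) (subst sum.swap, simp add: ac_simps)

lemma hermitian_row:
  assumes "hermitian A"
  shows "(\<Sum>i\<in>UNIV. cnj (w $ i) * A $ i $ x) = cnj ((A *v w) $ x)"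
  using assms by (simp add: matrix_vector_mult_def hermitian_cnj mult.commute)

text \<open>Restricts the form to a line along one coordinate axis, where it is a quadratic
  polynomial in \<open>t\<close>. Diagonal entries, zero diagonals and Schur complements are all
  handled by choosing \<open>w\<close> and \<open>t\<close> here.\<close>

lemma quad_form_shift:
  assumes "hermitian A"
  shows "quad_form A (w - t *s axis x 1) = quad_form A w - cnj t * (A *v w) $ x
           - t * cnj ((A *v w) $ x) + t * cnj t * A $ x $ x"
proof -
  have col: "(A *v (w - t *s axis x 1)) $ i = (A *v w) $ i - t * A $ i $ x" for i
    by (simp add: matrix_vector_mult_diff_distrib vector_scalar_commute
        matrix_vector_mult_axis column_def)
  have ax: "(\<Sum>i\<in>UNIV. cnj (axis x 1 $ i) * f i) = f x" for f :: "_ \<Rightarrow> complex"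
    by (simp add: axis_def if_distrib[of cnj] if_distrib[of "\<lambda>c. c * _"] cong: if_cong)
  have "quad_form A (w - t *s axis x 1) =
      (\<Sum>i\<in>UNIV. cnj (w $ i) * (A *v w) $ i) - t * (\<Sum>i\<in>UNIV. cnj (w $ i) * A $ i $ x)
       - cnj t * (\<Sum>i\<in>UNIV. cnj (axis x 1 $ i) * ((A *v w) $ i - t * A $ i $ x))"
    unfolding quad_form_def col
    by (simp add: algebra_simps sum.distrib sum_subtractf sum_distrib_left)
  then show ?thesis
    unfolding ax hermitian_row[OF assms] by (simp add: quad_form_def algebra_simps)
qed

lemma psd_diag_nonneg:
  assumes "psd A"
  shows "0 \<le> Re (A $ x $ x)"
proof -
  \<comment> \<open>The argument is \<open>axis x 1\<close> itself, written in the shape of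
    \<open>quad_form_shift\<close>.\<close>
  have "quad_form A (0 - (-1) *s axis x 1) = A $ x $ x"
    using assms by (subst quad_form_shift) (auto simp: psd_iff quad_form_def)
  then show ?thesis
    using psd_quad_form[OF assms] by metis
qed

text \<open>With a zero diagonal entry the quadratic term in \<open>quad_form_shift\<close>
  vanishes. Along \<open>t = s * z\<close> the form is then affine in \<open>s\<close>, and it stays
  nonnegative only if its slope, a multiple of the squared modulus of \<open>z\<close>, is
  zero.\<close>

lemma psd_zero_diag:
  assumes "psd A" and "A $ x $ x = 0"
  shows "A $ x $ j = 0" and "A $ j $ x = 0"
proof -
  define w :: "complex^'a" where "w = axis j 1"
  define z where "z = A $ x $ j"
  have z: "(A *v w) $ x = z"
    unfolding w_def z_def matrix_vector_mult_axis by (simp add: column_def)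
  have herm: "hermitian A" using assms by (simp add: psd_iff)
  have le: "0 \<le> Re (quad_form A w) - 2 * s * (cmod z)\<^sup>2" for s :: real
  proof -
    have "0 \<le> Re (quad_form A (w - (of_real s * z) *s axis x 1))"
      using assms(1) by (rule psd_quad_form)
    also have "\<dots> = Re (quad_form A w) - 2 * s * (cmod z)\<^sup>2"
      unfolding quad_form_shift[OF herm] z assms(2) cmod_power2
      by (simp add: algebra_simps power2_eq_square)
    finally show ?thesis .
  qed
  have "z = 0"
  proof (rule ccontr)
    assume "z \<noteq> 0"
    then show False
      \<comment> \<open>This value of \<open>s\<close> makes the right-hand side of
        \<open>le\<close> equal to -1.\<close>
      using le[of "(Re (quad_form A w) + 1) / (2 * (cmod z)\<^sup>2)"] by simp
  qed
  then show "A $ x $ j = 0" "A $ j $ x = 0"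
    using hermitian_cnj[OF herm, of x j] by (simp_all add: z_def)
qed

text \<open>The pivot index is kept: for a nonzero pivot, row and column \<open>x\<close> become
  zero instead of being deleted, so the type does not change.\<close>

definition schur_complement :: "'n \<Rightarrow> complex^'n^'n \<Rightarrow> complex^'n^'n" where
  "schur_complement x A = (\<chi> i j. A $ i $ j - A $ i $ x * A $ x $ j / A $ x $ x)"

text \<open>Completing the square: the form of the complement at \<open>w\<close> is the form of
  \<open>A\<close> at \<open>w\<close> shifted along axis \<open>x\<close> by \<open>z / a\<close>,
  the shift that minimises it.\<close>

lemma psd_schur_complement:
  assumes "psd A" and "A $ x $ x \<noteq> 0"
  shows "psd (schur_complement x A)"
  unfolding psd_iff
proof (intro conjI allI)
  have herm: "hermitian A" using assms by (simp add: psd_iff)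
  show "hermitian (schur_complement x A)"
    using herm by (simp add: schur_complement_def hermitian_iff mult.commute)
  fix w
  define a where "a = A $ x $ x"
  define z where "z = (A *v w) $ x"
  have a: "cnj a = a" "a \<noteq> 0"
    using hermitian_cnj[OF herm] assms(2) by (auto simp: a_def)
  have "(schur_complement x A *v w) $ i = (A *v w) $ i - A $ i $ x * z / a" for i
    by (simp add: schur_complement_def matrix_vector_mult_def z_def a_def algebra_simps
        sum_subtractf sum_distrib_left sum_divide_distrib)
  then have "quad_form (schur_complement x A) w
      = quad_form A w - (\<Sum>i\<in>UNIV. cnj (w $ i) * A $ i $ x) * z / a"
    by (simp only: quad_form_def)
      (simp add: algebra_simps sum_subtractf sum_distrib_left sum_divide_distrib)
  also have "\<dots> = quad_form A w - cnj z * z / a"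
    unfolding hermitian_row[OF herm] z_def ..
  also have "\<dots> = quad_form A (w - (z / a) *s axis x 1)"
    unfolding quad_form_shift[OF herm] z_def[symmetric] a_def[symmetric]
    using a by (simp add: field_simps)
  finally show "0 \<le> Re (quad_form (schur_complement x A) w)"
    using psd_quad_form[OF assms(1)] by simp
qed

text \<open>The part removed from \<open>A\<close> is column \<open>x\<close> times row
  \<open>x\<close> over the pivot. Hermiticity makes that row the conjugate of the column, so its
  trace against \<open>B\<close> is a value of the form of \<open>B\<close>.\<close>

lemma trace_schur_complement:
  assumes "hermitian A"
  shows "trace (A ** B) = trace (schur_complement x A ** B)
           + quad_form B (column x A) / A $ x $ x"
proof -
  have "quad_form B (column x A) = (\<Sum>i\<in>UNIV. \<Sum>j\<in>UNIV. A $ x $ i * (B $ i $ j * A $ j $ x))"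
    by (simp add: quad_form_def matrix_vector_mult_def column_def hermitian_cnj[OF assms]
        sum_distrib_left)
  also have "\<dots> = (\<Sum>j\<in>UNIV. \<Sum>i\<in>UNIV. A $ j $ x * A $ x $ i * B $ i $ j)"
    by (subst sum.swap) (simp add: ac_simps)
  finally show ?thesis
    by (simp add: trace_def matrix_matrix_mult_def schur_complement_def algebra_simps
        sum_subtractf sum_divide_distrib)
qed

text \<open>Schur complements peel rank-one terms off \<^term>\<open>A\<close>, shrinking its support, so no
  spectral theorem or square root is needed.\<close>

lemma trace_mult_psd_nonneg:
  assumes "psd A" and B: "psd B"
  shows "0 \<le> Re (trace (A ** B))"
proof -
  have "0 \<le> Re (trace (A ** B))"
    \<comment> \<open>Induction on a set \<open>X\<close> of indices that supports both the rows and
      the columns of \<open>A\<close>.\<close>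
    if "finite X" "psd A" "\<And>i j. i \<notin> X \<or> j \<notin> X \<Longrightarrow> A $ i $ j = 0" for X A
    using that
  proof (induction X arbitrary: A rule: finite_induct)
    case empty
    then show ?case by (simp add: trace_def matrix_matrix_mult_def)
  next
    case (insert x X)
    have herm: "hermitian A" using insert.prems by (simp add: psd_iff)
    show ?case
    proof (cases "A $ x $ x = 0")
      case True
      show ?thesis
      proof (rule insert.IH[OF insert.prems(1)])
        fix i j assume "i \<notin> X \<or> j \<notin> X"
        then show "A $ i $ j = 0"
          using insert.prems(2)[of i j] psd_zero_diag[OF insert.prems(1) True] by auto
      qed
    next
      case False
      have "0 \<le> Re (trace (schur_complement x A ** B))"
      proof (rule insert.IH[OF psd_schur_complement[OF insert.prems(1) False]])
        fix i j assume "i \<notin> X \<or> j \<notin> X"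
        then show "schur_complement x A $ i $ j = 0"
          using insert.prems(2)[of i j] insert.prems(2)[of i x] insert.prems(2)[of x j] False
          \<comment> \<open>In row or column \<open>x\<close> the subtracted term equals the entry,
            since the pivot cancels.\<close>
          by (cases "i = x"; cases "j = x") (auto simp: schur_complement_def)
      qed
      moreover have "0 \<le> Re (quad_form B (column x A) / A $ x $ x)"
        by (subst hermitian_diag_real[OF herm])
          (simp only: Re_divide_of_real divide_nonneg_nonneg psd_quad_form[OF B]
            psd_diag_nonneg[OF insert.prems(1)])
      ultimately show ?thesis
        by (simp add: trace_schur_complement[OF herm, of B x])
    qed
  qed
  from this[of UNIV A] show ?thesis using assms by simp
qed

lemma psd_congruence:
  assumes "psd A" and S: "hermitian S"
  shows "psd (S ** A ** S)"
  unfolding psd_iff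
proof (intro conjI allI)
  have "hermitian A" using assms by (simp add: psd_iff)
  then show "hermitian (S ** A ** S)"
    using S by (simp add: hermitian_def adj_mult matrix_mul_assoc)
  fix v
  have "quad_form (S ** A ** S) v = (\<Sum>i\<in>UNIV. cnj (v $ i) * (S *v (A *v (S *v v))) $ i)"
    by (simp add: quad_form_def matrix_vector_mul_assoc matrix_mul_assoc)
  also have "\<dots> = quad_form A (S *v v)"
    using S by (subst quad_form_adjoint) (simp add: hermitian_def quad_form_def)
  finally show "0 \<le> Re (quad_form (S ** A ** S) v)"
    using psd_quad_form[OF assms(1)] by simp
qed

lemma trace_sandwich_nonneg:
  assumes "psd A" "psd B" "hermitian S"
  shows "0 \<le> Re (trace (A ** S ** B ** S))"
  using trace_mult_psd_nonneg[OF assms(1) psd_congruence[OF assms(2,3)]]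
  by (simp add: matrix_mul_assoc)

section \<open>Trace identities for Hermitian matrices\<close>

lemma trace_cyclic3:
  fixes A B C :: "'a::comm_semiring_1^'n^'n"
  shows "trace (A ** B ** C) = trace (C ** A ** B)"
  using trace_mul_sym[of "A ** B" C] by (simp only: matrix_mul_assoc)

lemma trace_hermitian_mult_real:
  assumes "hermitian A" "hermitian B"
  shows "Im (trace (A ** B)) = 0"
proof -
  have "cnj (trace (A ** B)) = trace (B ** A)"
    using assms by (simp add: hermitian_def adj_mult flip: trace_adj)
  also have "\<dots> = trace (A ** B)" by (rule trace_mul_sym)
  finally show ?thesis by (simp add: complex_eq_iff)
qed

text \<open>The two traces are complex conjugates: the adjoint reverses the product and cyclicity
  restores the order. This merges the two cross terms of
  \<open>trace_complement_sandwich\<close>.\<close>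

lemma Re_trace_swap:
  assumes "hermitian A" "hermitian B" "hermitian S"
  shows "Re (trace (A ** B ** S)) = Re (trace (A ** S ** B))"
proof -
  have "cnj (trace (A ** B ** S)) = trace (S ** B ** A)"
    using assms by (simp add: hermitian_def adj_mult matrix_mul_assoc flip: trace_adj)
  also have "\<dots> = trace (A ** S ** B)" by (rule trace_cyclic3)
  finally show ?thesis by (metis cnj.sel(1))
qed

lemma trace_complement_sandwich:
  fixes A B S :: "complex^'n^'n"
  shows "trace (A ** (mat 1 - S) ** B ** (mat 1 - S)) =
    trace (A ** B) - trace (A ** S ** B) - trace (A ** B ** S) + trace (A ** S ** B ** S)"
  by (simp add: matrix_diff_ldistrib matrix_diff_rdistrib trace_sub)

section \<open>Diagonal matrices\<close>

lemma eigenvalues_diagonal: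
  fixes f :: "'n::finite \<Rightarrow> real"
  shows "eigenvalues (\<chi> i j. if i = j then complex_of_real (f i) else 0) = range f"
    (is "eigenvalues ?D = _")
proof -
  have D: "(?D *v v) $ i = of_real (f i) * v $ i" for v i
    by (simp add: matrix_vector_mult_def if_distrib[of "\<lambda>c. c * _"] cong: if_cong)
  show ?thesis
  proof (intro set_eqI iffI)
    fix l assume "l \<in> eigenvalues ?D"
    then obtain v where "v \<noteq> 0" and v: "?D *v v = complex_of_real l *s v"
      by (auto simp: eigenvalues_def)
    then obtain i where "v $ i \<noteq> 0" by (auto simp: vec_eq_iff)
    moreover have "of_real (f i) * v $ i = of_real l * v $ i"
      using arg_cong[OF v, of "\<lambda>u. u $ i"] by (simp add: D)
    ultimately show "l \<in> range f" by auto
  next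
    fix l assume "l \<in> range f"
    then obtain i where l: "l = f i" by auto
    have "?D *v axis i 1 = complex_of_real l *s axis i 1"
      unfolding vec_eq_iff D by (simp add: l axis_def)
    moreover have "axis i (1::complex) \<noteq> 0" by simp
    ultimately show "l \<in> eigenvalues ?D" unfolding eigenvalues_def by blast
  qed
qed

section \<open>The pigeonhole scenario\<close>

lemma prod_indicator:
  "finite A \<Longrightarrow> (\<Prod>k\<in>A. if P k then 1 else 0) = (if \<forall>k\<in>A. P k then 1 else (0::complex))"
  by (induction A rule: finite_induct) auto

lemma tensor3_basis_proj_nth:
  "tensor3 (\<lambda>k. if k \<in> p then basis_proj b else mat 1) $ c $ d
     = (if c = d \<and> (\<forall>k\<in>p. c k = b) then 1 else 0)"
proof -
  have "(if k \<in> p then basis_proj b else mat 1) $ c k $ d k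
      = (if c k = d k \<and> (k \<in> p \<longrightarrow> c k = b) then 1 else 0)" for k
    by (auto simp: basis_proj_def mat_def)
  then show ?thesis
    by (auto simp: tensor3_def prod_indicator)
qed

lemma Pi_same_nth:
  "Pi_same p $ c $ d = (if c = d then (if \<forall>k\<in>p. c k = L then 1 else 0)
                                      + (if \<forall>k\<in>p. c k = R then 1 else 0) else 0)"
  by (simp add: Pi_same_def tensor3_basis_proj_nth)

lemma hermitian_Pi_same: "hermitian (Pi_same p)"
  by (simp add: hermitian_iff Pi_same_nth)

lemma hermitian_Pi_diff: "hermitian (Pi_diff p)"
  by (simp add: hermitian_iff Pi_diff_def Pi_same_nth mat_def)

section \<open>The three pairs and the spectrum of \<open>Theta\<close>\<close>

lemma pairs_eq: "pairs = {{1, 2}, {1, 3}, {2, 3}}"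
proof -
  have ex3: "(\<exists>i. P i) \<longleftrightarrow> P 1 \<or> P 2 \<or> P 3" for P :: "3 \<Rightarrow> bool"
    by (metis exhaust_3)
  have "p \<in> pairs \<longleftrightarrow> p = {1, 2} \<or> p = {1, 3} \<or> p = {2, 3}" for p
    unfolding pairs_def mem_Collect_eq ex3 by (simp add: insert_commute) blast
  then show ?thesis
    by (intro set_eqI) (simp only: insert_iff empty_iff simp_thms)
qed

lemma sum_pairs: "(\<Sum>p\<in>pairs. g p) = g {1, 2} + g {1, 3} + g {2, 3}"
  for g :: "3 set \<Rightarrow> 'a::comm_monoid_add"
proof -
  \<comment> \<open>Distinctness of the three sets is what lets \<open>sum.insert\<close> count each
    of them once.\<close>
  have "(1::3) \<noteq> 2" "(1::3) \<noteq> 3" "(2::3) \<noteq> 3" by simp_all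
  then have "{1, 2} \<notin> {{1, 3}, {2, 3::3}}" "{1, 3} \<notin> {{2, 3::3}}"
    by (simp_all only: insert_iff empty_iff doubleton_eq_iff simp_thms)
  then show ?thesis
    unfolding pairs_eq by (simp only: sum.insert sum.empty finite.intros empty_iff not_False_eq_True
        add_0_right add.assoc)
qed

text \<open>The set \<open>{i, j}\<close> is nonempty, so the indicators for \<open>L\<close> and
  \<open>R\<close> in \<open>Pi_same_nth\<close> exclude each other; as \<open>box\<close> has two
  values, together they cover \<open>c i = c j\<close>.\<close>

lemma Pi_same_pair_nth: "Pi_same {i, j} $ c $ d = (if c = d \<and> c i = c j then 1 else 0)"
  by (cases "c = d"; cases "c i"; cases "c j") (simp_all add: Pi_same_nth)

text \<open>Of three two-valued entries, either all agree or exactly one pair does.\<close>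

lemma Theta_eq_diagonal:
  "Theta = (\<chi> c d. if c = d then
     complex_of_real (if c 1 = c 2 \<and> c 2 = c 3 then 3 else 1) else 0)"
proof -
  have "Theta $ c $ d = (if c = d then
     complex_of_real (if c 1 = c 2 \<and> c 2 = c 3 then 3 else 1) else 0)" for c d
    unfolding Theta_def vector_add_component Pi_same_pair_nth
    by (cases "c = d"; cases "c 1"; cases "c 2"; cases "c 3") simp_all
  then show ?thesis by (simp add: vec_eq_iff)
qed

lemma eigenvalues_Theta: "eigenvalues Theta = {1, 3}"
proof -
  define f :: "(3 \<Rightarrow> box) \<Rightarrow> real"
    where "f c = (if c 1 = c 2 \<and> c 2 = c 3 then 3 else 1)" for c
  \<comment> \<open>Witnesses for the two eigenvalues: all particles in one box, and one particle
    moved to the other.\<close>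
  have "f (\<lambda>_. L) = 3" "f ((\<lambda>_. L)(1 := R)) = 1"
    by (simp_all add: f_def)
  then have "{1, 3} \<subseteq> range f"
    using rangeI[of f "\<lambda>_. L"] rangeI[of f "(\<lambda>_. L)(1 := R)"] by simp
  moreover have "range f \<subseteq> {1, 3}"
    by (rule image_subsetI) (simp add: f_def)
  moreover have "eigenvalues Theta = range f"
    unfolding Theta_eq_diagonal f_def by (rule eigenvalues_diagonal)
  ultimately show ?thesis by blast
qed

section \<open>Consequences of the scenario\<close>

context
  fixes \<rho>\<^sub>I \<rho>\<^sub>F :: op3
  assumes PPS: "pigeonhole_PPS \<rho>\<^sub>I \<rho>\<^sub>F"
begin

lemma PPS_psd: "psd \<rho>\<^sub>I" "psd \<rho>\<^sub>F"
  using PPS by (auto simp: pigeonhole_PPS_def state_def)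

lemma PPS_hermitian: "hermitian \<rho>\<^sub>I" "hermitian \<rho>\<^sub>F"
  using PPS_psd by (auto simp: psd_iff)

lemma PPS_same_plus_diff:
  "p \<in> pairs \<Longrightarrow> p_same_pass \<rho>\<^sub>I \<rho>\<^sub>F p + p_diff_pass \<rho>\<^sub>I \<rho>\<^sub>F p = p_pass \<rho>\<^sub>I \<rho>\<^sub>F"
  using PPS by (auto simp: pigeonhole_PPS_def)

lemma PPS_p_same_pass:
  assumes "p \<in> pairs"
  shows "p_same_pass \<rho>\<^sub>I \<rho>\<^sub>F p = Re (trace (\<rho>\<^sub>F ** Pi_same p ** \<rho>\<^sub>I))"
proof -
  \<comment> \<open>The factor 2 comes from the two cross terms, whose real parts agree. Adding
    \<open>p_same_pass\<close> and equating with \<open>p_pass\<close> then determines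
    \<open>p_same_pass\<close>.\<close>
  have "p_diff_pass \<rho>\<^sub>I \<rho>\<^sub>F p = p_pass \<rho>\<^sub>I \<rho>\<^sub>F
      - 2 * Re (trace (\<rho>\<^sub>F ** Pi_same p ** \<rho>\<^sub>I)) + p_same_pass \<rho>\<^sub>I \<rho>\<^sub>F p"
    unfolding p_diff_pass_def p_pass_def p_same_pass_def Pi_diff_def trace_complement_sandwich
    by (simp add: Re_trace_swap PPS_hermitian hermitian_Pi_same)
  then show ?thesis
    using PPS_same_plus_diff[OF assms] by simp
qed

lemma PPS_ABL_same:
  assumes "p \<in> pairs"
  shows "ABL_same \<rho>\<^sub>I \<rho>\<^sub>F p = Re (weak_value \<rho>\<^sub>I \<rho>\<^sub>F (Pi_same p))"
proof -
  \<comment> \<open>The denominator of the weak value is real, so taking real parts commutes with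
    the division.\<close>
  have "trace (\<rho>\<^sub>F ** \<rho>\<^sub>I) = complex_of_real (p_pass \<rho>\<^sub>I \<rho>\<^sub>F)"
    using trace_hermitian_mult_real[OF PPS_hermitian(2,1)]
    by (simp add: p_pass_def complex_eq_iff)
  then show ?thesis
    unfolding ABL_same_def PPS_same_plus_diff[OF assms]
    by (simp add: weak_value_def PPS_p_same_pass[OF assms])
qed

lemma PPS_ABL_same_le_1: "ABL_same \<rho>\<^sub>I \<rho>\<^sub>F p \<le> 1"
proof -
  have "0 \<le> p_same_pass \<rho>\<^sub>I \<rho>\<^sub>F p" "0 \<le> p_diff_pass \<rho>\<^sub>I \<rho>\<^sub>F p"
    unfolding p_same_pass_def p_diff_pass_def
    by (simp_all add: trace_sandwich_nonneg PPS_psd hermitian_Pi_same hermitian_Pi_diff)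
  then show ?thesis
    \<comment> \<open>A zero denominator is covered too: the quotient is then 0.\<close>
    unfolding ABL_same_def divide_le_eq_1 by linarith
qed

lemma PPS_sum_ABL_same:
  "(\<Sum>p\<in>pairs. ABL_same \<rho>\<^sub>I \<rho>\<^sub>F p) = Re (weak_value \<rho>\<^sub>I \<rho>\<^sub>F Theta)"
proof -
  have "weak_value \<rho>\<^sub>I \<rho>\<^sub>F Theta = (\<Sum>p\<in>pairs. weak_value \<rho>\<^sub>I \<rho>\<^sub>F (Pi_same p))"
    unfolding sum_pairs
    by (simp add: weak_value_def Theta_def matrix_add_ldistrib matrix_add_rdistrib
        trace_add add_divide_distrib)
  then show ?thesis
    by (simp add: PPS_ABL_same)
qed

end

theorem mainTheorem4:
  fixes \<rho>\<^sub>I \<rho>\<^sub>F :: op3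
  assumes "pigeonhole_PPS \<rho>\<^sub>I \<rho>\<^sub>F"
  shows "(\<Sum>p\<in>pairs. ABL_same \<rho>\<^sub>I \<rho>\<^sub>F p) = Re (weak_value \<rho>\<^sub>I \<rho>\<^sub>F Theta)
    \<and> min_eigenvalue Theta = 1
    \<and> (pigeonhole_paradox \<rho>\<^sub>I \<rho>\<^sub>F \<longleftrightarrow> Re (weak_value \<rho>\<^sub>I \<rho>\<^sub>F Theta) < 1)
    \<and> (pigeonhole_paradox \<rho>\<^sub>I \<rho>\<^sub>F \<longleftrightarrow> anomalous \<rho>\<^sub>I \<rho>\<^sub>F Theta)
    \<and> (pigeonhole_paradox \<rho>\<^sub>I \<rho>\<^sub>F \<longrightarrow> complex_anomalous \<rho>\<^sub>I \<rho>\<^sub>F Theta)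
    \<and> (Im (weak_value \<rho>\<^sub>I \<rho>\<^sub>F Theta) = 0 \<longrightarrow>
         (pigeonhole_paradox \<rho>\<^sub>I \<rho>\<^sub>F \<longleftrightarrow> complex_anomalous \<rho>\<^sub>I \<rho>\<^sub>F Theta))"
proof -
  let ?w = "weak_value \<rho>\<^sub>I \<rho>\<^sub>F Theta"
  have sum: "(\<Sum>p\<in>pairs. ABL_same \<rho>\<^sub>I \<rho>\<^sub>F p) = Re ?w"
    by (rule PPS_sum_ABL_same[OF assms])
  \<comment> \<open>This bound excludes an anomaly above the spectrum, so leaving the interval from
    1 to 3 means falling below 1.\<close>
  have "(\<Sum>p\<in>pairs. ABL_same \<rho>\<^sub>I \<rho>\<^sub>F p) \<le> 3"
    unfolding sum_pairs
    using PPS_ABL_same_le_1[OF assms, of "{1, 2}"] PPS_ABL_same_le_1[OF assms, of "{1, 3}"]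
      PPS_ABL_same_le_1[OF assms, of "{2, 3}"] by linarith
  then have le: "Re ?w \<le> 3" by (simp add: sum)
  have min: "min_eigenvalue Theta = 1" and max: "max_eigenvalue Theta = 3"
    by (simp_all add: min_eigenvalue_def max_eigenvalue_def eigenvalues_Theta)
  have paradox: "pigeonhole_paradox \<rho>\<^sub>I \<rho>\<^sub>F \<longleftrightarrow> Re ?w < 1"
    by (auto simp: pigeonhole_paradox_def sum)
  have anom: "anomalous \<rho>\<^sub>I \<rho>\<^sub>F Theta \<longleftrightarrow> Re ?w < 1"
    using le by (auto simp: anomalous_def min max)
  \<comment> \<open>Lying on the real segment requires a zero imaginary part, which adds the second
    disjunct; it disappears when the weak value is real.\<close>
  have "complex_anomalous \<rho>\<^sub>I \<rho>\<^sub>F Theta \<longleftrightarrow> Re ?w < 1 \<or> Im ?w \<noteq> 0"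
    using le by (auto simp: complex_anomalous_def min max image_iff complex_eq_iff)
  then show ?thesis
    using sum min paradox anom by blast
qed

end
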